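(* Let $d>2$ be an integer. The average value of $h_p(\vec t)$ as $\vec t$ varies is $O(p^{\frac{d-1}{d}}\log p)$: there is a constant $C_d$ such that for every prime $p$, $$\mathbb{E}_{\vec t}\,[h_p(\vec t)]\ \le\ C_d\,p^{\frac{d-1}{d}}\log p,$$ where $\vec t=(t_1,\dots,t_{d-1},1)$ with $(t_1,\dots,t_{d-1})$ uniformly distributed in $\mathbb{Z}_p^{d-1}$.
   Context: $\mathbb{Z}_p=\mathbb{Z}/p\mathbb{Z}$. For $\vec t=(t_1,\dots,t_{d-1},1)\in\mathbb{Z}_p^d$, $$h_p(\vec{t}):=\min_{0<a<p}\ \max\big((at_1)\bmod p,\dots,(at_{d-1})\bmod p,\ a\big),$$ where $a$ ranges over integers and $m\bmod p$ denotes the representative in $\{0,1,\dots,p-1\}$. *)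

theory Defs
  imports "HOL-Probability.Probability" "HOL-Computational_Algebra.Primes"
begin

text \<open>
  Elements of \<open>\<int>/p\<int>\<close> are given by their representatives in \<open>{0..<p}\<close>. A vector
  \<open>(t\<^sub>1, \<dots>, t\<^sub>d\<^sub>-\<^sub>1, 1)\<close> is given by its free coordinates, as a function on \<open>{1..d-1}\<close>.
\<close>

definition Zp_vectors :: "nat \<Rightarrow> nat \<Rightarrow> (nat \<Rightarrow> int) set" where
  "Zp_vectors p n = {1..n} \<rightarrow>\<^sub>E {0..<int p}"

text \<open>
  The inserted \<open>a\<close> is the entry belonging to the last coordinate \<open>1\<close>. The outer \<open>Min\<close> ranges over a
  nonempty set as soon as \<open>p \<ge> 2\<close>.
\<close>

definition h :: "nat \<Rightarrow> nat \<Rightarrow> (nat \<Rightarrow> int) \<Rightarrow> int" where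
  "h p d t =
     Min ((\<lambda>a. Max (insert a ((\<lambda>i. (a * t i) mod int p) ` {1..d - 1}))) ` {0<..<int p})"

end

theory Submission
  imports Defs
begin

text \<open>
  Put \<open>n = d - 1\<close> and \<open>A = \<lceil>p powr (n / d)\<rceil>\<close>. For \<open>s \<ge> 2 * A\<close>, \<open>h p d t > s\<close> forces the number of
  multipliers \<open>a \<in> {A<..2 * A}\<close> with \<open>(a * t i) mod p \<le> s\<close> for all \<open>i\<close> to vanish. By Chebyshev's
  inequality this has probability at most the average over pairs \<open>(a, b)\<close> of \<open>R a b ^ n - 1\<close>, where
  \<open>R a b\<close> is the probability that both \<open>a * u\<close> and \<open>b * u\<close> have residue at most \<open>s\<close>, relative to the
  independent case. Counting lattice points line by line gives
  \<open>R a b \<le> 1 + O(A / s) + O(p * gcd a b / (A * s))\<close>; large gcds are rare, so the average is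
  \<open>O(A / s)\<close>. Summing this tail bound over \<open>s < p\<close> costs the factor \<open>log p\<close>. Restricting the
  multipliers to size \<open>A\<close> rather than \<open>s\<close> is what makes the discrepancy term decay in \<open>s\<close>, and
  \<open>d > 2\<close> enters through \<open>p\<^sup>2 \<le> A ^ 3\<close>.
\<close>

section \<open>Residue classes in intervals\<close>

text \<open>Distinct elements of \<open>D\<close> lie at least \<open>b\<close> apart, so the blocks
  \<open>{y..<y + b}\<close> with \<open>y \<in> D\<close> are disjoint. All but the last stay at or
  below \<open>Max D\<close> and hence, by convexity, inside \<open>I\<close>; the last may stick
  out, which costs the extra \<open>b\<close>.\<close>

lemma card_congruent_le:
  fixes I D :: "int set" and b :: int
  assumes "finite I" and convex: "\<And>x y z. x \<in> I \<Longrightarrow> z \<in> I \<Longrightarrow> x \<le> y \<Longrightarrow> y \<le> z \<Longrightarrow> y \<in> I"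
    and "D \<subseteq> I" and cong: "\<And>x y. x \<in> D \<Longrightarrow> y \<in> D \<Longrightarrow> b dvd x - y" and "b > 0"
  shows "b * int (card D) \<le> int (card I) + b"
proof (cases "D = {}")
  case False
  have fin: "finite D" using assms(1,3) finite_subset by blast
  define E where "E = D - {Max D}"
  have "inj_on (\<lambda>(y, r). y + r) (E \<times> {0..<b})"
  proof (rule inj_onI)
    fix u v assume "u \<in> E \<times> {0..<b}" "v \<in> E \<times> {0..<b}" "(\<lambda>(y, r). y + r) u = (\<lambda>(y, r). y + r) v"
    moreover obtain y r y' r' where uv: "u = (y, r)" "v = (y', r')" by (cases u, cases v)
    ultimately have *: "y \<in> D" "y' \<in> D" "0 \<le> r" "r < b" "0 \<le> r'" "r' < b" "y + r = y' + r'"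
      by (auto simp: E_def)
    then have "y - y' = r' - r" by simp
    then have "b dvd r' - r" using cong * by metis
    then have "r' mod b = r mod b" by (simp add: mod_eq_dvd_iff)
    then show "u = v" using * uv by simp
  qed
  moreover have "(\<lambda>(y, r). y + r) ` (E \<times> {0..<b}) \<subseteq> I"
  proof (rule image_subsetI)
    fix u assume "u \<in> E \<times> {0..<b}"
    moreover obtain y r where u: "u = (y, r)" by (cases u)
    ultimately have *: "y \<in> D" "y \<noteq> Max D" "0 \<le> r" "r < b"
      by (auto simp: E_def)
    have max: "Max D \<in> D" "y < Max D" using * fin False by (auto simp: order_less_le)
    then have "b \<le> Max D - y" using cong * zdvd_imp_le by (metis diff_gt_0_iff_gt)
    then have "y + r \<le> Max D" "y \<in> I" "Max D \<in> I" using max * assms(3) by auto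
    then show "(\<lambda>(y, r). y + r) u \<in> I" using convex[of y "Max D" "y + r"] * u by simp
  qed
  ultimately have "card (E \<times> {0..<b}) \<le> card I"
    using assms(1) card_inj_on_le by blast
  then have "int (card E) * b \<le> int (card I)"
    using assms(5) by (metis card_atLeastLessThan_int card_cartesian_product diff_zero
      int_nat_eq less_imp_le of_nat_le_iff of_nat_mult)
  moreover have "card D = card E + 1"
    using fin False unfolding E_def by (metis Max_in Suc_eq_plus1 card_Suc_Diff1)
  ultimately show ?thesis by (simp add: algebra_simps)
qed (use assms in auto)

text \<open>The values \<open>m * p + c\<close> lie in one residue class modulo \<open>p\<close> and
  determine \<open>m\<close>.\<close>

lemma card_multiples_int_le:
  fixes l u c p :: int
  assumes "p > 0" "u \<ge> l"
  shows "p * int (card {m. l \<le> m * p + c \<and> m * p + c \<le> u}) \<le> u - l + 1 + p"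
proof -
  let ?D = "(\<lambda>m. m * p + c) ` {m. l \<le> m * p + c \<and> m * p + c \<le> u}"
  have "p * int (card ?D) \<le> int (card {l..u}) + p"
    by (rule card_congruent_le) (use assms in \<open>auto simp flip: left_diff_distrib\<close>)
  moreover have "card ?D = card {m. l \<le> m * p + c \<and> m * p + c \<le> u}"
    by (rule card_image) (use assms in \<open>auto simp: inj_on_def\<close>)
  ultimately show ?thesis using assms by simp
qed

section \<open>Multiplication modulo a prime\<close>

lemma inj_on_mult_mod_prime:
  fixes a :: int
  assumes "prime p" "0 < a" "a < int p"
  shows "inj_on (\<lambda>t. (a * t) mod int p) {0..<int p}"
proof (rule inj_onI)
  fix x y assume *: "x \<in> {0..<int p}" "y \<in> {0..<int p}" "(a * x) mod int p = (a * y) mod int p"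
  have "int p dvd a * (x - y)" using * by (simp add: mod_eq_dvd_iff algebra_simps)
  then have "int p dvd a \<or> int p dvd x - y"
    using assms(1) by (simp add: prime_dvd_mult_iff)
  then have "int p dvd x - y" using assms zdvd_not_zless by blast
  then show "x = y" using * by (metis atLeastLessThan_iff mod_eq_dvd_iff mod_pos_pos_trivial)
qed

text \<open>Multiplication by \<open>a\<close> permutes the residues, so \<open>{0..s}\<close> has
  as many preimages as elements.\<close>

lemma card_mult_mod_le:
  fixes a s :: int
  assumes "prime p" "0 < a" "a < int p" "0 \<le> s" "s < int p"
  shows "card {t \<in> {0..<int p}. (a * t) mod int p \<le> s} = nat (s + 1)"
proof -
  let ?f = "\<lambda>t. (a * t) mod int p"
  have p: "int p > 0" using assms by simp
  have inj: "inj_on ?f {0..<int p}" using inj_on_mult_mod_prime assms by blast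
  have "?f ` {0..<int p} = {0..<int p}"
    by (rule endo_inj_surj) (use inj p in auto)
  then have "?f ` {t \<in> {0..<int p}. ?f t \<le> s} = {0..s}"
    (is "?f ` ?S = _")
  proof -
    have "?f ` ?S = {z \<in> ?f ` {0..<int p}. z \<le> s}" by auto
    then show ?thesis using \<open>?f ` {0..<int p} = _\<close> assms(5) by auto
  qed
  then have "card {t \<in> {0..<int p}. ?f t \<le> s} = card {0..s}"
    using inj by (metis (no_types, lifting) card_image inj_on_subset mem_Collect_eq subsetI)
  then show ?thesis by simp
qed

section \<open>Joint residues of two multiples\<close>

text \<open>Normalised as \<open>pair_count p s a b * p / (s + 1)\<^sup>2\<close>, this is the ratio
  \<open>R a b\<close> of the introduction.\<close>

definition pair_count :: "nat \<Rightarrow> int \<Rightarrow> int \<Rightarrow> int \<Rightarrow> nat" where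
  "pair_count p s a b =
     card {t \<in> {0..<int p}. (a * t) mod int p \<le> s \<and> (b * t) mod int p \<le> s}"

text \<open>
  Writing \<open>x\<close> and \<open>y\<close> for the residues of \<open>a * t\<close> and \<open>b * t\<close>, the point \<open>(x, y)\<close> lies on one of the
  lines \<open>b' * x - a' * y = m * p\<close>. On each line the admissible \<open>y\<close> form a single residue class
  modulo \<open>b'\<close>, so its density in the admissible interval is \<open>1 / b'\<close> up to one point; summing the
  interval lengths over \<open>m\<close> first gives the main term.
\<close>

lemma pair_count_le:
  fixes a' b' g s :: int
  assumes "prime p" and "0 < g" "0 < a'" "0 < b'" "coprime a' b'"
    and "g * b' < int p" and "0 \<le> s"
  shows "int p * b' * int (pair_count p s (g * a') (g * b'))
           \<le> (s + 1) * (b' * (s + 1) + int p) + b' * ((a' + b') * (s + 1) + int p)"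
proof -
  define q where "q = int p"
  have q: "q > 0" using assms(1) prime_gt_0_nat q_def by auto
  define T where "T = {t \<in> {0..<q}. (g * a' * t) mod q \<le> s \<and> (g * b' * t) mod q \<le> s}"
  \<comment> \<open>Only for \<open>m \<in> K\<close> can the line
    \<open>b' * x - a' * y = m * q\<close> meet the square \<open>0 \<le> x, y \<le> s\<close>. The
    \<open>+ 0\<close> gives the shape of \<open>card_multiples_int_le\<close> with
    \<open>c = 0\<close>.\<close>
  define K where "K = {m. - a' * s \<le> m * q + 0 \<and> m * q + 0 \<le> b' * s}"
  \<comment> \<open>\<open>I m\<close> admits a fractional \<open>x = (m * q + a' * y) / b'\<close>
    between \<open>0\<close> and \<open>s\<close>; \<open>D m\<close> asks in addition that
    \<open>x\<close> be an integer.\<close>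
  define I where "I = (\<lambda>m. {y \<in> {0..s}. 0 \<le> m * q + a' * y \<and> m * q + a' * y \<le> b' * s})"
  define D where "D = (\<lambda>m. {y \<in> I m. b' dvd m * q + a' * y})"
  \<comment> \<open>\<open>f\<close> maps \<open>t\<close> to the index of its line and its
    \<open>y\<close>. The index arises from splitting both sides of
    \<open>a' * (g * b' * t) = b' * (g * a' * t)\<close> into quotient and residue modulo
    \<open>q\<close>.\<close>
  define f where "f = (\<lambda>t. (a' * (g * b' * t div q) - b' * (g * a' * t div q), (g * b' * t) mod q))"
  have finI: "finite (I m)" for m
    by (rule finite_subset[of _ "{0..s}"]) (auto simp: I_def)
  have finD: "finite (D m)" for m using finI by (simp add: D_def)
  have s0: "- a' * s \<le> b' * s" using assms by (smt (verit) mult_nonneg_nonneg mult_minus_left)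
  have finK: "finite K"
  proof (rule finite_imageD)
    show "finite ((\<lambda>m. m * q + 0) ` K)"
      by (rule finite_subset[of _ "{- a' * s..b' * s}"]) (auto simp: K_def)
    show "inj_on (\<lambda>m. m * q + 0) K" using q by (auto simp: inj_on_def)
  qed
  have gb: "0 < g * b'" using assms(2,4) by simp
  \<comment> \<open>The residue \<open>y\<close> alone determines \<open>t\<close>, because
    \<open>0 < g * b' < p\<close>.\<close>
  have "inj_on (\<lambda>t. (g * b' * t) mod q) T"
    using inj_on_mult_mod_prime[OF assms(1) gb assms(6), folded q_def]
    by (rule inj_on_subset) (auto simp only: T_def)
  moreover have "snd \<circ> f = (\<lambda>t. (g * b' * t) mod q)" by (rule ext) (simp only: f_def comp_def snd_conv)
  ultimately have "inj_on (snd \<circ> f) T" by (simp only:)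
  then have injf: "inj_on f T" by (rule inj_on_imageI2)
  have imf: "f ` T \<subseteq> Sigma K D"
  proof
    fix z assume "z \<in> f ` T"
    then obtain t where t: "t \<in> T" "z = f t" by auto
    define x where "x = (g * a' * t) mod q"
    define y where "y = (g * b' * t) mod q"
    define m where "m = a' * (g * b' * t div q) - b' * (g * a' * t div q)"
    have xy: "0 \<le> x" "x \<le> s" "0 \<le> y" "y \<le> s" using t q unfolding T_def x_def y_def by auto
    have "m * q + a' * y = a' * ((g * b' * t div q) * q + y) - b' * (g * a' * t div q) * q"
      unfolding m_def by (simp add: algebra_simps)
    also have "(g * b' * t div q) * q + y = g * b' * t" unfolding y_def by simp
    also have "a' * (g * b' * t) = b' * ((g * a' * t div q) * q + x)" unfolding x_def by simp
    finally have line: "m * q + a' * y = b' * x" by (simp add: algebra_simps)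
    have le: "0 \<le> b' * x" "b' * x \<le> b' * s" "0 \<le> a' * y" "a' * y \<le> a' * s"
      using xy assms by (auto intro: mult_left_mono)
    have "m \<in> K" unfolding K_def using line le by auto
    moreover have "y \<in> D m" unfolding D_def I_def using line le xy by auto
    ultimately show "z \<in> Sigma K D" using t unfolding f_def m_def y_def by auto
  qed
  have "card T \<le> card (Sigma K D)"
    using card_inj_on_le[OF injf imf] finK finD by auto
  also have "\<dots> = (\<Sum>m\<in>K. card (D m))" using finK finD by simp
  finally have "b' * int (card T) \<le> b' * (\<Sum>m\<in>K. int (card (D m)))"
    using assms(4) by (simp flip: of_nat_sum)
  also have "\<dots> = (\<Sum>m\<in>K. b' * int (card (D m)))" by (simp add: sum_distrib_left)
  also have "\<dots> \<le> (\<Sum>m\<in>K. int (card (I m)) + b')"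
  proof (rule sum_mono, rule card_congruent_le)
    fix m assume "m \<in> K"
    show "D m \<subseteq> I m" unfolding D_def by auto
    show "b' dvd x - y" if "x \<in> D m" "y \<in> D m" for x y
    proof -
      have "b' dvd (m * q + a' * x) - (m * q + a' * y)"
        using that unfolding D_def by (intro dvd_diff) auto
      then have "b' dvd a' * (x - y)" by (simp add: algebra_simps)
      then show ?thesis using assms(5) by (metis coprime_commute coprime_dvd_mult_right_iff)
    qed
    show "y \<in> I m" if "x \<in> I m" "z \<in> I m" "x \<le> y" "y \<le> z" for x y z
    proof -
      have "a' * x \<le> a' * y" "a' * y \<le> a' * z" using that assms by auto
      then show ?thesis using that unfolding I_def by auto
    qed
  qed (use finI assms in auto)
  also have "\<dots> = int (\<Sum>m\<in>K. card (I m)) + b' * int (card K)" by (simp add: sum.distrib)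
  \<comment> \<open>Double counting: at each fixed \<open>y\<close> it remains to count the
    multiples of \<open>q\<close> in a shifted interval of length \<open>b' * s\<close>.\<close>
  also have "(\<Sum>m\<in>K. card (I m)) = (\<Sum>y\<in>{0..s}. card {m \<in> K. 0 \<le> m * q + a' * y \<and> m * q + a' * y \<le> b' * s})"
    unfolding I_def by (rule sum_multicount_gen) (use finK in auto)
  finally have "q * (b' * int (card T)) \<le>
      q * (int (\<Sum>y\<in>{0..s}. card {m \<in> K. 0 \<le> m * q + a' * y \<and> m * q + a' * y \<le> b' * s}) + b' * int (card K))"
    using q by simp
  also have "\<dots> = (\<Sum>y\<in>{0..s}. q * int (card {m \<in> K. 0 \<le> m * q + a' * y \<and> m * q + a' * y \<le> b' * s}))
                  + b' * (q * int (card K))"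
    by (simp add: sum_distrib_left algebra_simps)
  also have "\<dots> \<le> (\<Sum>y\<in>{0..s}. b' * (s + 1) + q) + b' * ((a' + b') * (s + 1) + q)"
  proof (rule add_mono, goal_cases)
    case 1
    show ?case
    proof (rule sum_mono)
      fix y assume y: "y \<in> {0..s}"
      have "{m \<in> K. 0 \<le> m * q + a' * y \<and> m * q + a' * y \<le> b' * s}
         = {m. 0 \<le> m * q + a' * y \<and> m * q + a' * y \<le> b' * s}"
      proof -
        have "0 \<le> a' * y" "a' * y \<le> a' * s" using y assms by auto
        then show ?thesis unfolding K_def by auto
      qed
      then show "q * int (card {m \<in> K. 0 \<le> m * q + a' * y \<and> m * q + a' * y \<le> b' * s}) \<le> b' * (s + 1) + q"
        using card_multiples_int_le[of q 0 "b' * s" "a' * y"] q assms by (simp add: distrib_left)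
    qed
  next
    case 2
    have "q * int (card K) \<le> (a' + b') * (s + 1) + q"
      using card_multiples_int_le[OF q s0, of 0] assms unfolding K_def by (simp add: algebra_simps)
    then show ?case using assms(4) by (intro mult_left_mono) auto
  qed
  also have "(\<Sum>y\<in>{0..s}. b' * (s + 1) + q) = (s + 1) * (b' * (s + 1) + q)" using assms by simp
  finally show ?thesis unfolding pair_count_def T_def q_def by (simp add: mult.assoc)
qed

section \<open>Power sums of greatest common divisors\<close>

text \<open>\<open>gcd a b ^ k\<close> is at most the sum of \<open>g ^ k\<close> over the common
  divisors \<open>g\<close>. The window contains at most \<open>2 * A / g\<close> multiples of
  \<open>g\<close>, so each \<open>g\<close> contributes at most
  \<open>(2 * A / g)\<^sup>2 * g ^ k \<le> (2 * A) ^ k\<close>; the last bound uses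
  \<open>k \<ge> 2\<close>.\<close>

lemma sum_gcd_power_le:
  fixes A k :: nat
  assumes "k \<ge> 2"
  shows "(\<Sum>a\<in>{A<..2*A}. \<Sum>b\<in>{A<..2*A}. gcd a b ^ k) \<le> (2 * A) ^ (k + 1)"
proof -
  let ?W = "{A<..2*A}"
  define c where "c g = card {a \<in> ?W. g dvd a}" for g
  have c: "g * c g \<le> 2 * A" if "g \<in> {1..2*A}" for g
  proof -
    have "{a \<in> ?W. g dvd a} \<subseteq> (*) g ` {1..2 * A div g}"
    proof
      fix a assume "a \<in> {a \<in> ?W. g dvd a}"
      then obtain j where "a = g * j" "a \<le> 2 * A" "a > A" unfolding dvd_def by auto
      moreover from this have "j > 0" by (cases j) auto
      ultimately show "a \<in> (*) g ` {1..2 * A div g}"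
        using that by (intro image_eqI[of _ _ j]) (auto simp: less_eq_div_iff_mult_less_eq mult.commute Suc_le_eq)
    qed
    then have "c g \<le> 2 * A div g"
      unfolding c_def using surj_card_le[of "{1..2 * A div g}"] by simp
    then show ?thesis by (metis mult_le_mono2 order_trans times_div_less_eq_dividend)
  qed
  have "gcd a b ^ k \<le> (\<Sum>g\<in>{1..2*A}. (of_bool (g dvd a) * of_bool (g dvd b)) * g ^ k)"
    if "a \<in> ?W" "b \<in> ?W" for a b
  proof -
    have "gcd a b \<in> {1..2*A}"
      using that by (auto simp: Suc_le_eq intro: order_trans[OF gcd_le1_nat])
    then have "(of_bool (gcd a b dvd a) * of_bool (gcd a b dvd b)) * gcd a b ^ k
        \<le> (\<Sum>g\<in>{1..2*A}. (of_bool (g dvd a) * of_bool (g dvd b)) * g ^ k)"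
      by (rule member_le_sum) auto
    then show ?thesis by simp
  qed
  then have "(\<Sum>a\<in>?W. \<Sum>b\<in>?W. gcd a b ^ k)
      \<le> (\<Sum>a\<in>?W. \<Sum>b\<in>?W. \<Sum>g\<in>{1..2*A}. (of_bool (g dvd a) * of_bool (g dvd b)) * g ^ k)"
    by (intro sum_mono)
  also have "\<dots> = (\<Sum>a\<in>?W. \<Sum>g\<in>{1..2*A}. \<Sum>b\<in>?W. (of_bool (g dvd a) * of_bool (g dvd b)) * g ^ k)"
    by (rule sum.cong[OF refl], rule sum.swap)
  also have "\<dots> = (\<Sum>g\<in>{1..2*A}. \<Sum>a\<in>?W. \<Sum>b\<in>?W. (of_bool (g dvd a) * of_bool (g dvd b)) * g ^ k)"
    by (rule sum.swap)
  also have "\<dots> = (\<Sum>g\<in>{1..2*A}. c g * c g * g ^ k)"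
  proof (rule sum.cong[OF refl])
    fix g
    have "c g = (\<Sum>a\<in>?W. of_bool (g dvd a))"
      unfolding c_def by (simp add: sum_of_bool_eq Int_def)
    then have "c g * c g = (\<Sum>a\<in>?W. \<Sum>b\<in>?W. of_bool (g dvd a) * of_bool (g dvd b))"
      by (simp only: sum_product)
    then show "(\<Sum>a\<in>?W. \<Sum>b\<in>?W. (of_bool (g dvd a) * of_bool (g dvd b)) * g ^ k) = c g * c g * g ^ k"
      by (simp only: sum_distrib_right)
  qed
  also have "\<dots> \<le> (\<Sum>g\<in>{1..2*A}. (2 * A) ^ k)"
  proof (rule sum_mono)
    fix g assume g: "g \<in> {1..2*A}"
    obtain j where k: "k = j + 2" using assms by (metis add.commute le_Suc_ex)
    have "c g * c g * g ^ k = (g * c g) * (g * c g) * g ^ j"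
      by (simp add: k power_add power2_eq_square)
    also have "\<dots> \<le> (2 * A) * (2 * A) * (2 * A) ^ j"
      using g by (intro mult_le_mono[OF mult_le_mono[OF c[OF g] c[OF g]]] power_mono) auto
    finally show "c g * c g * g ^ k \<le> (2 * A) ^ k" by (simp add: k power_add power2_eq_square)
  qed
  finally show ?thesis by simp
qed

section \<open>Chebyshev's inequality and bounds for powers\<close>

text \<open>Chebyshev's inequality without division: each zero of \<open>N\<close> contributes
  \<open>(sum N T)\<^sup>2\<close> to the sum of the squared deviations
  \<open>card T * N t - sum N T\<close>.\<close>

lemma card_zeros_le:
  fixes N :: "'a \<Rightarrow> real"
  assumes "finite T"
  shows "real (card {t \<in> T. N t = 0}) * (sum N T)\<^sup>2
           \<le> (real (card T))\<^sup>2 * (\<Sum>t\<in>T. (N t)\<^sup>2) - real (card T) * (sum N T)\<^sup>2"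
proof -
  define m where "m = real (card T)"
  define S where "S = sum N T"
  have "real (card {t \<in> T. N t = 0}) * S\<^sup>2 = (\<Sum>t\<in>{t \<in> T. N t = 0}. (m * N t - S)\<^sup>2)"
    by simp
  also have "\<dots> \<le> (\<Sum>t\<in>T. (m * N t - S)\<^sup>2)"
    using assms by (intro sum_mono2) auto
  also have "\<dots> = (\<Sum>t\<in>T. m\<^sup>2 * (N t)\<^sup>2 - 2 * m * S * N t + S\<^sup>2)"
    by (intro sum.cong refl) (simp add: power2_eq_square algebra_simps)
  also have "\<dots> = m\<^sup>2 * (\<Sum>t\<in>T. (N t)\<^sup>2) - 2 * m * S * S + m * S\<^sup>2"
    by (simp add: sum.distrib sum_subtractf sum_distrib_left m_def S_def)
  finally show ?thesis unfolding m_def S_def by (simp add: power2_eq_square mult_ac)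
qed

text \<open>For \<open>z \<le> 1\<close> the convex function \<open>(1 + z) ^ n\<close> lies below
  its chord over the interval from 0 to 1; for larger \<open>z\<close>,
  \<open>1 + z \<le> 2 * z\<close>.\<close>

lemma one_plus_power_le:
  fixes z :: real
  assumes "z \<ge> 0"
  shows "(1 + z) ^ n \<le> 1 + 2 ^ n * (z + z ^ n)"
proof (cases "z \<le> 1")
  case True
  have "(1 + z) ^ n \<le> 1 + (2 ^ n - 1) * z"
  proof (induction n)
    case (Suc n)
    have "(1 + z) ^ Suc n \<le> (1 + (2 ^ n - 1) * z) * (1 + z)"
      using Suc assms by (simp add: mult.commute mult_left_mono)
    also have "\<dots> = 1 + 2 ^ n * z + (2 ^ n - 1) * (z * z)" by (simp add: algebra_simps)
    also have "(2 ^ n - 1) * (z * z) \<le> (2 ^ n - 1) * (z * 1)"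
      using True assms by (intro mult_left_mono) auto
    finally show ?case by (simp add: algebra_simps)
  qed simp
  also have "\<dots> \<le> 1 + 2 ^ n * (z + z ^ n)"
    using assms by (simp add: algebra_simps)
  finally show ?thesis .
next
  case False
  then have "(1 + z) ^ n \<le> (2 * z) ^ n" by (intro power_mono) auto
  also have "\<dots> = 2 ^ n * z ^ n" by (simp add: power_mult_distrib)
  also have "\<dots> \<le> 1 + 2 ^ n * (z + z ^ n)" using assms by (simp add: distrib_left)
  finally show ?thesis .
qed

lemma add_power_le:
  fixes x y :: real
  assumes "x \<ge> 0" "y \<ge> 0"
  shows "(x + y) ^ n \<le> 2 ^ n * (x ^ n + y ^ n)"
proof -
  have "(x + y) ^ n \<le> (2 * max x y) ^ n" using assms by (intro power_mono) auto
  also have "\<dots> = 2 ^ n * (max x y) ^ n" by (simp add: power_mult_distrib)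
  also have "\<dots> \<le> 2 ^ n * (x ^ n + y ^ n)" using assms by (intro mult_left_mono) (auto simp: max_def)
  finally show ?thesis .
qed

text \<open>Intended for \<open>q = A / (s + 1)\<close> and \<open>y\<close> the gcd term. The
  linear term in \<open>y\<close> is traded for \<open>q + y\<^sup>2 / q\<close>, so that
  \<open>y\<close> occurs only with exponents \<open>2\<close> and \<open>n\<close>, which
  \<open>sum_gcd_power_le\<close> can average when \<open>n \<ge> 2\<close>.\<close>

lemma power_le_of_le_one_plus:
  fixes R q y :: real
  assumes "0 \<le> R" "R \<le> 1 + 5 * q + y" "0 < q" "q \<le> 1" "0 \<le> y" "n \<ge> 1"
  shows "R ^ n \<le> 1 + 2 ^ n * ((6 + 10 ^ n) * q + y\<^sup>2 / q + 2 ^ n * y ^ n)"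
proof -
  have "R ^ n \<le> (1 + (5 * q + y)) ^ n" using assms by (intro power_mono) auto
  also have "\<dots> \<le> 1 + 2 ^ n * ((5 * q + y) + (5 * q + y) ^ n)"
    using assms by (intro one_plus_power_le) auto
  also have "\<dots> \<le> 1 + 2 ^ n * ((6 * q + y\<^sup>2 / q) + 2 ^ n * (5 ^ n * q + y ^ n))"
  proof (rule add_left_mono, rule mult_left_mono, rule add_mono)
    show "5 * q + y \<le> 6 * q + y\<^sup>2 / q"
    proof (cases "y \<le> q")
      case False
      then have "y * q \<le> y * y" using assms by (intro mult_left_mono) auto
      then have "y \<le> y\<^sup>2 / q" using assms by (simp add: field_simps power2_eq_square)
      then show ?thesis using assms by simp
    next
      case True
      moreover have "y\<^sup>2 / q \<ge> 0" using assms by simp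
      ultimately show ?thesis by linarith
    qed
    have "(5 * q + y) ^ n \<le> 2 ^ n * ((5 * q) ^ n + y ^ n)"
      using assms by (intro add_power_le) auto
    \<comment> \<open>Here \<open>q \<le> 1\<close> and \<open>n \<ge> 1\<close> give
      \<open>q ^ n \<le> q\<close>.\<close>
    also have "(5 * q) ^ n \<le> 5 ^ n * q"
      using assms power_decreasing[of 1 n q] by (simp add: power_mult_distrib)
    finally show "(5 * q + y) ^ n \<le> 2 ^ n * (5 ^ n * q + y ^ n)" by simp
  qed auto
  also have "\<dots> = 1 + 2 ^ n * ((6 + 10 ^ n) * q + y\<^sup>2 / q + 2 ^ n * y ^ n)"
  proof -
    have "(10 :: real) ^ n = 2 ^ n * 5 ^ n" by (simp flip: power_mult_distrib)
    then show ?thesis by (simp add: algebra_simps)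
  qed
  finally show ?thesis .
qed

section \<open>Vectors and the moments of the hit count\<close>

lemma card_Zp_vectors_all:
  "card {t \<in> Zp_vectors p n. \<forall>i\<in>{1..n}. P (t i)} = card {u \<in> {0..<int p}. P u} ^ n"
proof -
  have "{t \<in> Zp_vectors p n. \<forall>i\<in>{1..n}. P (t i)} = {1..n} \<rightarrow>\<^sub>E {u \<in> {0..<int p}. P u}"
    unfolding Zp_vectors_def PiE_def Pi_def by auto
  then show ?thesis by (simp add: card_PiE)
qed

lemma finite_Zp_vectors: "finite (Zp_vectors p n)"
  unfolding Zp_vectors_def by (intro finite_PiE) auto

lemma card_Zp_vectors: "card (Zp_vectors p n) = p ^ n"
  unfolding Zp_vectors_def by (simp add: card_PiE)

lemma h_le:
  assumes "0 < a" "a < int p" "a \<le> s" "\<And>i. i \<in> {1..d - 1} \<Longrightarrow> (a * t i) mod int p \<le> s"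
  shows "h p d t \<le> s"
proof -
  have "h p d t \<le> Max (insert a ((\<lambda>i. (a * t i) mod int p) ` {1..d - 1}))"
    unfolding h_def using assms by (intro Min_le) auto
  also have "\<dots> \<le> s" using assms by (subst Max_le_iff) auto
  finally show ?thesis .
qed

text \<open>The last coordinate needs no condition: its entry is \<open>a\<close> itself, and
  \<open>a \<le> 2 * A \<le> s\<close> wherever this is applied.\<close>

definition hits :: "nat \<Rightarrow> nat \<Rightarrow> nat \<Rightarrow> int \<Rightarrow> (nat \<Rightarrow> int) \<Rightarrow> real" where
  "hits p n A s t = (\<Sum>a\<in>{A<..2*A}. of_bool (\<forall>i\<in>{1..n}. (int a * t i) mod int p \<le> s))"

lemma sum_hits:
  assumes "prime p" "2 * A \<le> s" "s < p"
  shows "(\<Sum>t\<in>Zp_vectors p n. hits p n A (int s) t) = real A * (real s + 1) ^ n"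
proof -
  have "(\<Sum>t\<in>Zp_vectors p n. hits p n A (int s) t)
      = (\<Sum>a\<in>{A<..2*A}. \<Sum>t\<in>Zp_vectors p n. of_bool (\<forall>i\<in>{1..n}. (int a * t i) mod int p \<le> int s))"
    unfolding hits_def by (rule sum.swap)
  also have "\<dots> = (\<Sum>a\<in>{A<..2*A}. (real s + 1) ^ n)"
  proof (rule sum.cong[OF refl])
    fix a assume "a \<in> {A<..2*A}"
    then have "card {u \<in> {0..<int p}. (int a * u) mod int p \<le> int s} = s + 1"
      using card_mult_mod_le[OF assms(1), of "int a" "int s"] assms by simp
    then show "(\<Sum>t\<in>Zp_vectors p n. of_bool (\<forall>i\<in>{1..n}. (int a * t i) mod int p \<le> int s)) = (real s + 1) ^ n"
      using card_Zp_vectors_all[of p n "\<lambda>u. (int a * u) mod int p \<le> int s"]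
      by (simp add: sum_of_bool_eq finite_Zp_vectors Int_def add.commute)
  qed
  finally show ?thesis by simp
qed

text \<open>Expanding the square gives a sum over pairs of multipliers; for each pair the
  coordinates are independent, hence the \<open>n\<close>-th power.\<close>

lemma sum_hits_squared:
  "(\<Sum>t\<in>Zp_vectors p n. (hits p n A s t)\<^sup>2)
     = (\<Sum>a\<in>{A<..2*A}. \<Sum>b\<in>{A<..2*A}. real (pair_count p s (int a) (int b)) ^ n)"
proof -
  let ?c = "\<lambda>a t. \<forall>i\<in>{1..n}. (int a * t i) mod int p \<le> s"
  have "(\<Sum>t\<in>Zp_vectors p n. (hits p n A s t)\<^sup>2)
      = (\<Sum>t\<in>Zp_vectors p n. \<Sum>a\<in>{A<..2*A}. \<Sum>b\<in>{A<..2*A}. of_bool (?c a t \<and> ?c b t))"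
    unfolding hits_def power2_eq_square sum_product of_bool_conj ..
  also have "\<dots> = (\<Sum>a\<in>{A<..2*A}. \<Sum>t\<in>Zp_vectors p n. \<Sum>b\<in>{A<..2*A}. of_bool (?c a t \<and> ?c b t))"
    by (rule sum.swap)
  also have "\<dots> = (\<Sum>a\<in>{A<..2*A}. \<Sum>b\<in>{A<..2*A}. \<Sum>t\<in>Zp_vectors p n. of_bool (?c a t \<and> ?c b t))"
    by (intro sum.cong[OF refl] sum.swap)
  also have "\<dots> = (\<Sum>a\<in>{A<..2*A}. \<Sum>b\<in>{A<..2*A}. real (pair_count p s (int a) (int b)) ^ n)"
  proof (intro sum.cong refl)
    fix a b
    have "(\<Sum>t\<in>Zp_vectors p n. of_bool (?c a t \<and> ?c b t) :: real)
        = real (card {t \<in> Zp_vectors p n. ?c a t \<and> ?c b t})"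
      by (simp add: sum_of_bool_eq finite_Zp_vectors Int_def)
    also have "{t \<in> Zp_vectors p n. ?c a t \<and> ?c b t}
        = {t \<in> Zp_vectors p n. \<forall>i\<in>{1..n}. (int a * t i) mod int p \<le> s \<and> (int b * t i) mod int p \<le> s}"
      by blast
    also have "card \<dots> = pair_count p s (int a) (int b) ^ n"
      using card_Zp_vectors_all[of p n "\<lambda>u. (int a * u) mod int p \<le> s \<and> (int b * u) mod int p \<le> s"]
      unfolding pair_count_def .
    finally show "(\<Sum>t\<in>Zp_vectors p n. of_bool (?c a t \<and> ?c b t) :: real)
        = real (pair_count p s (int a) (int b)) ^ n" by simp
  qed
  finally show ?thesis .
qed

section \<open>Correlation of two multipliers\<close>

text \<open>With \<open>r = s + 1\<close>, dividing \<open>pair_count_le\<close> by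
  \<open>b' * r\<^sup>2\<close> leaves the independent main term \<open>1\<close> and three errors:
  \<open>(a' + b') / r \<le> 4 * A / r\<close>, then \<open>p / r\<^sup>2 \<le> A / r\<close> by
  \<open>p \<le> A\<^sup>2 \<le> A * s\<close>, and \<open>p / (b' * r)\<close>, where
  \<open>b' = b / g\<close> exceeds \<open>A / g\<close>.\<close>

lemma pair_count_ratio_le:
  fixes p A s a b :: nat
  assumes "prime p" "p \<le> A\<^sup>2" "2 * A \<le> s" "s < p"
    and a: "a \<in> {A<..2*A}" and b: "b \<in> {A<..2*A}"
  shows "real (pair_count p (int s) (int a) (int b)) * real p / (real s + 1)\<^sup>2
      \<le> 1 + 5 * (real A / (real s + 1)) + real p / (real A * (real s + 1)) * real (gcd a b)"
proof -
  define g where "g = gcd a b"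
  define M where "M = real (pair_count p (int s) (int a) (int b))"
  define r where "r = real s + 1"
  have pos: "a > 0" "b > 0" "g > 0" "A > 0" "r > 0"
    using a b by (simp_all add: g_def r_def)
  obtain a' b' where ab: "a = g * a'" "b = g * b'" "coprime a' b'"
    using gcd_coprime_exists[of a b] pos unfolding g_def by (metis mult.commute not_gr0)
  have pos': "a' > 0" "b' > 0" using pos ab by simp_all
  have "int p * int b' * int (pair_count p (int s) (int g * int a') (int g * int b'))
      \<le> (int s + 1) * (int b' * (int s + 1) + int p) + int b' * ((int a' + int b') * (int s + 1) + int p)"
    by (rule pair_count_le) (use assms pos pos' ab in \<open>auto simp flip: of_nat_mult\<close>)
  then have "real_of_int (int p * int b' * int (pair_count p (int s) (int g * int a') (int g * int b')))
      \<le> real_of_int ((int s + 1) * (int b' * (int s + 1) + int p) + int b' * ((int a' + int b') * (int s + 1) + int p))"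
    by (simp only: of_int_le_iff)
  then have *: "real p * real b' * M \<le> r * (real b' * r + real p) + real b' * ((real a' + real b') * r + real p)"
    by (simp add: M_def r_def ab)
  have "M * real p / r\<^sup>2 = (real p * real b' * M) / (real b' * r\<^sup>2)" using pos pos' by simp
  also have "\<dots> \<le> (r * (real b' * r + real p) + real b' * ((real a' + real b') * r + real p)) / (real b' * r\<^sup>2)"
    using * pos by (intro divide_right_mono) auto
  also have "\<dots> = 1 + (real a' + real b') / r + real p / r\<^sup>2 + real p / (real b' * r)"
    using pos pos' by (simp add: field_simps power2_eq_square)
  also have "\<dots> \<le> 1 + 4 * (real A / r) + real A / r + real p / (real A * r) * real g"
  proof (intro add_mono order_refl)
    have "a' \<le> a" "b' \<le> b" using ab pos by auto
    then have "real a' + real b' \<le> 4 * real A" using a b by simp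
    then show "(real a' + real b') / r \<le> 4 * (real A / r)" using pos by (simp add: divide_right_mono)
    have "p \<le> A * s" using assms(2,3) by (metis mult_2 le_add1 mult_le_mono2 order_trans power2_eq_square)
    then have "real p \<le> real A * real s" by (metis of_nat_le_iff of_nat_mult)
    also have "\<dots> \<le> real A * r" by (simp add: r_def mult_left_mono)
    finally show "real p / r\<^sup>2 \<le> real A / r" using pos by (simp add: field_simps power2_eq_square)
    have "real A \<le> real b' * real g" using b ab by (simp add: mult.commute flip: of_nat_mult)
    then have "real p * real A \<le> real p * (real b' * real g)" by (intro mult_left_mono) auto
    then show "real p / (real b' * r) \<le> real p / (real A * r) * real g"
      using pos pos' by (simp add: field_simps)
  qed
  finally show ?thesis by (simp add: M_def r_def g_def algebra_simps)
qed

text \<open>The hypothesis \<open>p ^ k \<le> A ^ (k + 1)\<close> absorbs the powers of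
  \<open>p\<close>, so that the mean over the \<open>A\<^sup>2\<close> pairs is of order
  \<open>(A / r) ^ k\<close>.\<close>

lemma sum_gcd_power_scaled_le:
  fixes A p k :: nat and r :: real
  assumes "k \<ge> 2" "p ^ k \<le> A ^ (k + 1)" "A > 0" "r > 0"
  shows "(\<Sum>a\<in>{A<..2*A}. \<Sum>b\<in>{A<..2*A}. (real p / (real A * r) * real (gcd a b)) ^ k)
      \<le> 2 ^ (k + 1) * (real A)\<^sup>2 * (real A / r) ^ k"
proof -
  have "(\<Sum>a\<in>{A<..2*A}. \<Sum>b\<in>{A<..2*A}. (real p / (real A * r) * real (gcd a b)) ^ k)
      = (real p / (real A * r)) ^ k * real (\<Sum>a\<in>{A<..2*A}. \<Sum>b\<in>{A<..2*A}. gcd a b ^ k)"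
    by (simp only: power_mult_distrib sum_distrib_left of_nat_sum of_nat_power)
  also have "\<dots> \<le> (real p / (real A * r)) ^ k * real ((2 * A) ^ (k + 1))"
    using sum_gcd_power_le[OF assms(1), of A] assms
    by (intro mult_left_mono of_nat_mono) auto
  also have "\<dots> = real (p ^ k) * (2 ^ (k + 1) * real A / r ^ k)"
    using assms by (simp add: power_divide power_mult_distrib field_simps)
  also have "\<dots> \<le> real (A ^ (k + 1)) * (2 ^ (k + 1) * real A / r ^ k)"
    using assms by (intro mult_right_mono of_nat_mono) auto
  also have "\<dots> = 2 ^ (k + 1) * (real A)\<^sup>2 * (real A / r) ^ k"
    by (simp add: power_divide power2_eq_square field_simps)
  finally show ?thesis .
qed

section \<open>Tail bound for \<open>h\<close>\<close>

lemma card_h_greater_le: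
  fixes p A s n :: nat
  assumes "prime p" "p\<^sup>2 \<le> A ^ 3" "p ^ n \<le> A ^ (n + 1)" "2 * A \<le> s" "s < p" "n \<ge> 2"
  shows "real (card {t \<in> Zp_vectors p n. h p (n + 1) t > int s})
      \<le> 2 ^ n * (14 + 10 ^ n + 2 * 4 ^ n) * real p ^ n * (real A / (real s + 1))"
proof -
  let ?W = "{A<..2*A}" and ?T = "Zp_vectors p n"
  define r where "r = real s + 1"
  define q where "q = real A / r"
  define y where "y = (\<lambda>a b. real p / (real A * r) * real (gcd a b))"
  define M where "M = (\<lambda>a b. real (pair_count p (int s) (int a) (int b)))"
  define Z where "Z = {t \<in> ?T. hits p n A (int s) t = 0}"
  have p: "p > 0" using assms prime_gt_0_nat by blast
  have A: "A > 0" using assms(2) p by (auto intro!: gr0I)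
  \<comment> \<open>Since \<open>A ^ 3 \<le> A ^ 4\<close>, this also supplies the bound on
    \<open>p\<close> required by \<open>pair_count_ratio_le\<close>.\<close>
  have "p\<^sup>2 \<le> (A\<^sup>2)\<^sup>2"
    using assms(2) A power_increasing[of 3 4 A] by simp
  then have pA: "p \<le> A\<^sup>2" by (rule power2_le_imp_le) simp
  have r: "r > 0" and q: "q > 0" "q \<le> 1"
    using A assms(4) by (auto simp: r_def q_def divide_simps)
  have y: "y a b \<ge> 0" for a b using r by (simp add: y_def)
  have "{t \<in> ?T. h p (n + 1) t > int s} \<subseteq> Z"
  proof
    fix t assume t: "t \<in> {t \<in> ?T. h p (n + 1) t > int s}"
    have "\<not> (\<forall>i\<in>{1..n}. (int a * t i) mod int p \<le> int s)" if "a \<in> ?W" for a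
      using h_le[of "int a" p "int s" "n + 1" t] t that assms(4,5) by force
    then have "hits p n A (int s) t = 0"
      unfolding hits_def by (intro sum.neutral) auto
    then show "t \<in> Z" using t by (simp add: Z_def)
  qed
  then have "real (card {t \<in> ?T. h p (n + 1) t > int s}) \<le> real (card Z)"
    by (intro of_nat_mono card_mono) (auto simp: Z_def finite_Zp_vectors)
  also have "\<dots> \<le> real p ^ n * ((\<Sum>a\<in>?W. \<Sum>b\<in>?W. (M a b * real p / r\<^sup>2) ^ n) / (real A)\<^sup>2 - 1)"
  proof -
    \<comment> \<open>\<open>S\<close> and \<open>Q\<close> are the sums of the hit count and of its
      square; division by \<open>S\<^sup>2\<close> turns the pair counts into the ratios
      \<open>M a b * p / r\<^sup>2\<close>.\<close>
    define S where "S = real A * r ^ n"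
    define Q where "Q = (\<Sum>a\<in>?W. \<Sum>b\<in>?W. M a b ^ n)"
    have S: "S > 0" using A r by (simp add: S_def)
    have Q: "(\<Sum>a\<in>?W. \<Sum>b\<in>?W. (M a b * real p / r\<^sup>2) ^ n) = Q * (real p / r\<^sup>2) ^ n"
      unfolding Q_def by (simp only: sum_distrib_right power_mult_distrib flip: times_divide_eq_right)
    have "real (card Z) * S\<^sup>2 \<le> (real p ^ n)\<^sup>2 * Q - real p ^ n * S\<^sup>2"
      using card_zeros_le[OF finite_Zp_vectors, of p n "hits p n A (int s)"]
      by (simp add: sum_hits[OF assms(1,4,5)] sum_hits_squared card_Zp_vectors Z_def S_def Q_def M_def r_def)
    then have "real (card Z) \<le> ((real p ^ n)\<^sup>2 * Q - real p ^ n * S\<^sup>2) / S\<^sup>2"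
      using S by (simp add: pos_le_divide_eq)
    also have "\<dots> = real p ^ n * (Q * (real p ^ n / S\<^sup>2) - 1)"
      using S by (simp add: field_simps power2_eq_square)
    also have "real p ^ n / S\<^sup>2 = (real p / r\<^sup>2) ^ n / (real A)\<^sup>2"
      by (simp add: S_def power_mult_distrib power_divide mult.commute flip: power_mult)
    finally show ?thesis unfolding Q by simp
  qed
  also have "\<dots> \<le> real p ^ n * (2 ^ n * (14 + 10 ^ n + 2 * 4 ^ n) * q)"
  proof (rule mult_left_mono)
    have "(\<Sum>a\<in>?W. \<Sum>b\<in>?W. (M a b * real p / r\<^sup>2) ^ n)
        \<le> (\<Sum>a\<in>?W. \<Sum>b\<in>?W. 1 + 2 ^ n * ((6 + 10 ^ n) * q + (y a b)\<^sup>2 / q + 2 ^ n * y a b ^ n))"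
    proof (intro sum_mono power_le_of_le_one_plus)
      fix a b assume "a \<in> ?W" "b \<in> ?W"
      then show "M a b * real p / r\<^sup>2 \<le> 1 + 5 * q + y a b"
        unfolding M_def r_def q_def y_def using pair_count_ratio_le assms(1,4,5) pA by blast
    qed (use q y assms(6) in \<open>auto simp: M_def\<close>)
    also have "\<dots> = (real A)\<^sup>2 + 2 ^ n * ((6 + 10 ^ n) * q * (real A)\<^sup>2
        + (\<Sum>a\<in>?W. \<Sum>b\<in>?W. (y a b)\<^sup>2) / q + 2 ^ n * (\<Sum>a\<in>?W. \<Sum>b\<in>?W. y a b ^ n))"
      by (simp only: sum.distrib sum_constant card_greaterThanAtMost
          flip: sum_distrib_left sum_divide_distrib)
        (simp add: power2_eq_square algebra_simps)
    \<comment> \<open>The gcd sums enter with \<open>k = 2\<close>, giving \<open>8 = 2 ^ 3\<close>,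
      and with \<open>k = n\<close>. Together with \<open>6\<close> the former makes
      \<open>14\<close>, while \<open>2 ^ n * 2 ^ (n + 1)\<close> makes
      \<open>2 * 4 ^ n\<close>.\<close>
    also have "\<dots> \<le> (real A)\<^sup>2 + 2 ^ n * ((6 + 10 ^ n) * q * (real A)\<^sup>2
        + 8 * q * (real A)\<^sup>2 + 2 ^ n * (2 ^ (n + 1) * (real A)\<^sup>2 * q))"
    proof (intro add_mono mult_left_mono order_refl)
      have "(\<Sum>a\<in>?W. \<Sum>b\<in>?W. (y a b)\<^sup>2) \<le> 8 * (real A)\<^sup>2 * q\<^sup>2"
        using sum_gcd_power_scaled_le[of 2 p A r] assms(2) A r by (simp add: y_def q_def eval_nat_numeral)
      then show "(\<Sum>a\<in>?W. \<Sum>b\<in>?W. (y a b)\<^sup>2) / q \<le> 8 * q * (real A)\<^sup>2"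
        using q by (simp add: divide_simps power2_eq_square algebra_simps)
      have "(\<Sum>a\<in>?W. \<Sum>b\<in>?W. y a b ^ n) \<le> 2 ^ (n + 1) * (real A)\<^sup>2 * q ^ n"
        using sum_gcd_power_scaled_le[of n p A r] assms(3,6) A r by (simp add: y_def q_def)
      also have "\<dots> \<le> 2 ^ (n + 1) * (real A)\<^sup>2 * q"
        using power_decreasing[of 1 n q] assms(6) q by (intro mult_left_mono) auto
      finally show "(\<Sum>a\<in>?W. \<Sum>b\<in>?W. y a b ^ n) \<le> 2 ^ (n + 1) * (real A)\<^sup>2 * q" .
    qed (use q in auto)
    also have "\<dots> = (1 + 2 ^ n * (14 + 10 ^ n + 2 * 4 ^ n) * q) * (real A)\<^sup>2"
    proof -
      have "(4 :: real) ^ n = 2 ^ n * 2 ^ n" by (simp flip: power_mult_distrib)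
      then show ?thesis by (simp add: algebra_simps)
    qed
    finally have "(\<Sum>a\<in>?W. \<Sum>b\<in>?W. (M a b * real p / r\<^sup>2) ^ n) / (real A)\<^sup>2
        \<le> 1 + 2 ^ n * (14 + 10 ^ n + 2 * 4 ^ n) * q"
      using A by (simp only: pos_divide_le_eq zero_less_power of_nat_0_less_iff)
    then show "(\<Sum>a\<in>?W. \<Sum>b\<in>?W. (M a b * real p / r\<^sup>2) ^ n) / (real A)\<^sup>2 - 1
        \<le> 2 ^ n * (14 + 10 ^ n + 2 * 4 ^ n) * q" by linarith
  qed simp
  finally show ?thesis by (simp add: q_def r_def mult_ac)
qed

section \<open>From the tail bound to the mean\<close>

lemma h_less:
  assumes "p \<ge> 2"
  shows "h p d t < int p"
proof -
  have "(1 * t i) mod int p \<le> int p - 1" for i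
    using assms by (simp add: zle_diff1_eq)
  then have "h p d t \<le> int p - 1"
    using assms by (intro h_le[of 1]) auto
  then show ?thesis by simp
qed

text \<open>Layer-cake bound: a nonnegative integer \<open>x\<close> is the number of thresholds
  \<open>0 \<le> s < x\<close>, and at most \<open>m\<close> of these lie below
  \<open>m\<close>.\<close>

lemma le_plus_card_less:
  fixes x :: int and m p :: nat
  assumes "x < int p"
  shows "real_of_int x \<le> real m + real (card {s \<in> {m..<p}. int s < x})"
proof -
  have "card {m..<nat x} \<le> card {s \<in> {m..<p}. int s < x}"
    using assms by (intro card_mono) auto
  then show ?thesis by simp
qed

text \<open>The exponent \<open>k / (k + 1)\<close> increases with \<open>k\<close>, so one choice
  of \<open>A\<close> serves both \<open>k = 2\<close> and \<open>k = n\<close>.\<close>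

lemma power_le_power_Suc_of_powr_le:
  fixes p A k n :: nat
  assumes "real p powr (real n / (real n + 1)) \<le> real A" "p \<ge> 1" "k \<le> n"
  shows "p ^ k \<le> A ^ (k + 1)"
proof -
  have "real k / (real k + 1) \<le> real n / (real n + 1)"
    using assms(3) by (simp add: field_simps)
  then have "real p powr (real k / (real k + 1)) \<le> real A"
    using order_trans[OF powr_mono assms(1)] assms(2) by simp
  then have "(real p powr (real k / (real k + 1))) ^ (k + 1) \<le> real A ^ (k + 1)"
    by (intro power_mono) auto
  moreover have "(real p powr (real k / (real k + 1))) ^ (k + 1) = real p ^ k"
  proof -
    have "(real p powr (real k / (real k + 1))) ^ (k + 1)
        = (real p powr (real k / (real k + 1))) powr real (k + 1)"
      using assms(2) by (subst powr_realpow) auto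
    also have "\<dots> = real p powr (real k / (real k + 1) * real (k + 1))" by (rule powr_powr)
    also have "real k / (real k + 1) * real (k + 1) = real k"
      by (simp add: divide_eq_eq add_nonneg_eq_0_iff algebra_simps)
    finally show ?thesis using assms(2) by (simp add: powr_realpow)
  qed
  ultimately show ?thesis by (metis of_nat_le_iff of_nat_power)
qed

text \<open>The difference \<open>harm n - ln n\<close> decreases from its value \<open>1\<close> at
  \<open>n = 1\<close>.\<close>

lemma harm_le_one_plus_ln:
  assumes "n \<ge> 1"
  shows "harm n \<le> 1 + ln (real n)"
proof -
  obtain m where m: "n = Suc m" using assms by (cases n) auto
  have "harm (Suc m) - ln (real (Suc m)) \<le> harm (Suc 0) - ln (real (Suc 0))"
    using decseqD[OF decseq_harm_diff_ln, of 0 m] by simp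
  then show ?thesis unfolding m by (simp add: harm_expand)
qed

text \<open>Thresholds below \<open>2 * A\<close> are bounded trivially; above, the tail bound is a
  multiple of \<open>A / (s + 1)\<close>, whose sum over \<open>s\<close> is harmonic and produces
  the logarithm.\<close>

lemma sum_h_le:
  fixes p A n :: nat
  assumes "prime p" "p\<^sup>2 \<le> A ^ 3" "p ^ n \<le> A ^ (n + 1)" "n \<ge> 2"
  shows "(\<Sum>t\<in>Zp_vectors p n. real_of_int (h p (n + 1) t))
      \<le> real p ^ n * real A * (2 + 2 ^ n * (14 + 10 ^ n + 2 * 4 ^ n) * (1 + ln (real p)))"
proof -
  let ?T = "Zp_vectors p n"
  define K :: real where "K = 2 ^ n * (14 + 10 ^ n + 2 * 4 ^ n)"
  have p: "p \<ge> 2" using assms(1) prime_ge_2_nat by blast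
  have "(\<Sum>t\<in>?T. real_of_int (h p (n + 1) t))
      \<le> (\<Sum>t\<in>?T. real (2 * A) + real (card {s \<in> {2*A..<p}. int s < h p (n + 1) t}))"
    using h_less[OF p] by (intro sum_mono le_plus_card_less)
  also have "\<dots> = real p ^ n * real (2 * A) + real (\<Sum>t\<in>?T. card {s \<in> {2*A..<p}. int s < h p (n + 1) t})"
    by (simp add: sum.distrib card_Zp_vectors)
  also have "(\<Sum>t\<in>?T. card {s \<in> {2*A..<p}. int s < h p (n + 1) t})
      = (\<Sum>s\<in>{2*A..<p}. card {t \<in> ?T. int s < h p (n + 1) t})"
    by (rule sum_multicount_gen) (auto simp: finite_Zp_vectors)
  also have "real \<dots> = (\<Sum>s\<in>{2*A..<p}. real (card {t \<in> ?T. int s < h p (n + 1) t}))" by simp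
  also have "\<dots> \<le> (\<Sum>s\<in>{2*A..<p}. K * real p ^ n * (real A / (real s + 1)))"
    unfolding K_def using assms by (intro sum_mono card_h_greater_le) auto
  also have "\<dots> \<le> (\<Sum>s\<in>{..<p}. K * real p ^ n * (real A / (real s + 1)))"
    by (intro sum_mono2) (auto simp: K_def)
  also have "\<dots> = K * real p ^ n * real A * harm p"
    by (simp add: harm_altdef sum_distrib_left divide_inverse mult.assoc add.commute)
  also have "\<dots> \<le> K * real p ^ n * real A * (1 + ln (real p))"
    using harm_le_one_plus_ln[of p] p by (intro mult_left_mono) (auto simp: K_def)
  finally show ?thesis by (simp add: K_def algebra_simps)
qed

theorem theorem7p1:
  fixes d :: nat
  assumes "d > 2"
  shows "\<exists>C :: real. \<forall>p :: nat. prime p \<longrightarrow>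
           measure_pmf.expectation (pmf_of_set (Zp_vectors p (d - 1))) (\<lambda>t. real_of_int (h p d t))
             \<le> C * real p powr ((real d - 1) / real d) * ln (real p)"
proof -
  define n where "n = d - 1"
  have n: "d = n + 1" "n \<ge> 2" using assms by (auto simp: n_def)
  define K :: real where "K = 2 ^ n * (14 + 10 ^ n + 2 * 4 ^ n)"
  have K: "K > 0" unfolding K_def by (intro mult_pos_pos add_pos_pos) auto
  \<comment> \<open>In the constant, the factor \<open>2\<close> comes from rounding
    \<open>P\<close> up to \<open>A \<le> 2 * P\<close>, and \<open>(2 + K) / ln 2\<close> from
    absorbing \<open>2 + K\<close> into the logarithm by \<open>ln p \<ge> ln 2\<close>.\<close>
  have "measure_pmf.expectation (pmf_of_set (Zp_vectors p n)) (\<lambda>t. real_of_int (h p (n + 1) t))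
      \<le> 2 * ((2 + K) / ln 2 + K) * real p powr (real n / (real n + 1)) * ln (real p)"
    if "prime p" for p
  proof -
    define P where "P = real p powr (real n / (real n + 1))"
    define A where "A = nat \<lceil>P\<rceil>"
    have p: "p \<ge> 2" using that prime_ge_2_nat by blast
    have P: "P \<ge> 1" using p unfolding P_def by (intro ge_one_powr_ge_zero) auto
    have A: "P \<le> real A" "real A \<le> 2 * P" using P unfolding A_def by linarith+
    have ln: "ln (real p) \<ge> ln 2" using p by simp
    have pw: "p ^ k \<le> A ^ (k + 1)" if "k \<le> n" for k
      using power_le_power_Suc_of_powr_le[of p n A k] A(1) p that by (simp add: P_def)
    have "p ^ n > 0" using p by simp
    then have "Zp_vectors p n \<noteq> {}" using card_Zp_vectors[of p n] by force
    then have "measure_pmf.expectation (pmf_of_set (Zp_vectors p n)) (\<lambda>t. real_of_int (h p (n + 1) t))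
        = (\<Sum>t\<in>Zp_vectors p n. real_of_int (h p (n + 1) t)) / real p ^ n"
      by (subst integral_pmf_of_set) (auto simp: finite_Zp_vectors card_Zp_vectors)
    also have "\<dots> \<le> (real p ^ n * real A * (2 + K * (1 + ln (real p)))) / real p ^ n"
      \<comment> \<open>The instance \<open>k = 2\<close> needs \<open>n \<ge> 2\<close>, that is
        \<open>d > 2\<close>.\<close>
      unfolding K_def using that pw[of 2] pw[of n] n(2)
      by (intro divide_right_mono sum_h_le) (auto simp: eval_nat_numeral)
    also have "\<dots> = real A * (2 + K * (1 + ln (real p)))" using p by simp
    also have "\<dots> = real A * ((2 + K) * 1 + K * ln (real p))" by (simp add: algebra_simps)
    also have "\<dots> \<le> (2 * P) * ((2 + K) * (ln (real p) / ln 2) + K * ln (real p))"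
    proof (rule mult_mono)
      have "ln (real p) \<ge> 0" using p by simp
      then show "0 \<le> (2 + K) * 1 + K * ln (real p)" using K by simp
      show "(2 + K) * 1 + K * ln (real p) \<le> (2 + K) * (ln (real p) / ln 2) + K * ln (real p)"
        using K ln by (intro add_mono mult_left_mono) auto
    qed (use A P in auto)
    also have "\<dots> = 2 * ((2 + K) / ln 2 + K) * P * ln (real p)" by (simp add: algebra_simps)
    finally show ?thesis by (simp add: P_def)
  qed
  then show ?thesis unfolding n(1) by (intro exI[of _ "2 * ((2 + K) / ln 2 + K)"]) (simp add: add.commute)
qed

end
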